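(* Let $V$ be a vector space over $\mathbb{R}$ endowed with a norm $\|\cdot\|$, with dual space $V^*$, and suppose that $\mu$ is a Borel measure on $V^*$ such that $$\|x\|=\int_{V^*}|x\ell|\,\mu(\mathrm{d}\ell)\quad\text{for all }x\in V.$$ Let $x_1,\dots,x_n$ be any vectors in $V$ and let $\varepsilon_1,\dots,\varepsilon_n$ be independent Rademacher random variables. Then $$2\Big(\mathsf{E}\Big\|\sum_{i=1}^n\varepsilon_i x_i\Big\|\Big)^2\ge\Big(\int_{V^*}\sqrt{\sum_{i=1}^n(x_i\ell)^2}\,\mu(\mathrm{d}\ell)\Big)^2.$$
   Context: For $x\in V$ and $\ell\in V^*$, $x\ell$ denotes the value of the linear functional $\ell$ at $x$. A Rademacher random variable $\varepsilon$ satisfies $\mathsf{P}(\varepsilon=1)=\mathsf{P}(\varepsilon=-1)=\frac12$. $\mathsf{E}$ denotes expectation. *)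

theory Defs
  imports "HOL-Probability.Probability"
begin

definition rademacher :: "'w measure \<Rightarrow> ('w \<Rightarrow> real) \<Rightarrow> bool" where
  "rademacher P X \<longleftrightarrow>
     X \<in> borel_measurable P \<and>
     measure P {\<omega> \<in> space P. X \<omega> = 1} = 1 / 2 \<and>
     measure P {\<omega> \<in> space P. X \<omega> = - 1} = 1 / 2"

end

theory Submission
  imports Defs
begin

text \<open>
  The representation of the norm turns the claim into an inequality between scalars, namely
  Khinchine's inequality with Szarek's constant:
  \[ \sqrt{\sum_i a_i^2} \le \sqrt 2 \, E \Bigl|\sum_i \varepsilon_i a_i\Bigr| . \]
  Applied to \<open>a\<^sub>i = l (x\<^sub>i)\<close> and integrated over \<open>l\<close>, it bounds the integral of the square function by
  \<open>sqrt 2\<close> times the integral of \<open>E \<bar>l (\<Sum>\<epsilon>\<^sub>i x\<^sub>i)\<bar>\<close>. The expectation is an average over the \<open>2^n\<close> sign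
  patterns, so it can be interchanged with the integral although the measure need not be
  sigma-finite, and the
  integrals that appear are the norms of the signed sums (\<open>expectation_rademacher_sum\<close>).

  The scalar inequality is \<open>khinchine_cube\<close>. Its proof is the argument of Latala and Oleszkiewicz. On
  the discrete cube, let \<open>L f = (1/2) \<Sum>\<^sub>i (f - f \<circ> flip\<^sub>i)\<close>. This operator multiplies the Walsh function
  of a set \<open>S\<close> by the cardinality of \<open>S\<close>. An even function \<open>f\<close> has no Walsh coefficients of order one,
  so apart from its mean only orders at least \<open>2\<close> occur, and \<open>E (f L f) \<ge> 2 Var f\<close>
  (\<open>cube_poincare_even\<close>). If \<open>f\<close> is the absolute value of the linear form, the triangle inequality
  gives \<open>L f \<le> f\<close> pointwise, whence \<open>2 Var f \<le> E f\<^sup>2\<close>. This says \<open>E f\<^sup>2 \<le> 2 (E f)\<^sup>2\<close>, and the second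
  moment of the linear form is the sum of the \<open>a\<^sub>i\<^sup>2\<close>.

  Walsh expansions are avoided: the spectral estimate is proved by induction on the dimension, with
  the coefficients of order zero and one kept explicitly (\<open>cube_second_order_poincare\<close>).
\<close>

section \<open>Poincare inequalities on the discrete cube\<close>

text \<open>
  A point of the cube \<open>{-1, 1}^I\<close> is encoded as the set of its positive coordinates, so that the cube is
  \<open>Pow I\<close> and adding a coordinate is \<open>insert\<close>.
\<close>

definition spin :: "'a set \<Rightarrow> 'a \<Rightarrow> real" where
  "spin A i = (if i \<in> A then 1 else - 1)"

definition flip :: "'a \<Rightarrow> 'a set \<Rightarrow> 'a set" where
  "flip i A = (if i \<in> A then A - {i} else insert i A)"

definition cube_avg :: "'a set \<Rightarrow> ('a set \<Rightarrow> real) \<Rightarrow> real" where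
  "cube_avg I f = (\<Sum>A\<in>Pow I. f A) / 2 ^ card I"

text \<open>The Dirichlet form \<open>E (f L f)\<close>.\<close>

definition cube_energy :: "'a set \<Rightarrow> ('a set \<Rightarrow> real) \<Rightarrow> real" where
  "cube_energy I f = cube_avg I (\<lambda>A. \<Sum>i\<in>I. f A * (f A - f (flip i A)) / 2)"

lemma cube_avg_empty [simp]: "cube_avg {} f = f {}"
  by (simp add: cube_avg_def)

lemma cube_avg_insert:
  assumes "finite I" "j \<notin> I"
  shows "cube_avg (insert j I) f = cube_avg I (\<lambda>A. (f A + f (insert j A)) / 2)"
proof -
  have inj: "inj_on (insert j) (Pow I)"
    using assms(2) by (intro inj_onI) (metis PowD insert_ident subsetD)
  have disj: "Pow I \<inter> insert j ` Pow I = {}"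
    using assms(2) by auto
  have "(\<Sum>A\<in>Pow (insert j I). f A) = (\<Sum>A\<in>Pow I. f A) + (\<Sum>A\<in>insert j ` Pow I. f A)"
    unfolding Pow_insert using assms(1) disj by (intro sum.union_disjoint) auto
  also have "(\<Sum>A\<in>insert j ` Pow I. f A) = (\<Sum>A\<in>Pow I. f (insert j A))"
    by (simp add: sum.reindex[OF inj])
  finally show ?thesis
    using assms by (simp add: cube_avg_def sum.distrib sum_divide_distrib[symmetric])
qed

lemma cube_avg_cong:
  "(\<And>A. A \<subseteq> I \<Longrightarrow> f A = g A) \<Longrightarrow> cube_avg I f = cube_avg I g"
  unfolding cube_avg_def by (intro arg_cong2[where f = "(/)"] sum.cong) auto

lemma cube_avg_mono:
  "(\<And>A. A \<subseteq> I \<Longrightarrow> f A \<le> g A) \<Longrightarrow> cube_avg I f \<le> cube_avg I g"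
  by (auto simp: cube_avg_def intro!: divide_right_mono sum_mono)

lemma cube_avg_add: "cube_avg I (\<lambda>A. f A + g A) = cube_avg I f + cube_avg I g"
  by (simp add: cube_avg_def sum.distrib add_divide_distrib)

lemma cube_avg_minus: "cube_avg I (\<lambda>A. - f A) = - cube_avg I f"
  by (simp add: cube_avg_def sum_negf)

lemma cube_avg_const:
  assumes "finite I"
  shows "cube_avg I (\<lambda>A. c) = c"
  using assms by (simp add: cube_avg_def card_Pow)

lemma spin_insert: "spin (insert j A) i = (if i = j then 1 else spin A i)"
  by (simp add: spin_def)

lemma spin_flip: "spin (flip i A) k = (if k = i then - spin A k else spin A k)"
  by (cases "i \<in> A"; cases "k = i"; cases "k \<in> A"; simp add: spin_def flip_def)

text \<open>
  In the variable of the coordinate \<open>j\<close>, a function on the larger cube has the form \<open>g + s h\<close> with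
  \<open>s\<close> the sign at \<open>j\<close>; the average over \<open>s\<close> removes the cross term of its square. This lemma and
  \<open>cube_energy_insert\<close> carry the inductions on the dimension for the Poincare inequalities.
\<close>

lemma cube_avg_square_insert:
  assumes I: "finite I" "j \<notin> I"
  shows "cube_avg (insert j I) (\<lambda>A. (f A)\<^sup>2)
    = cube_avg I (\<lambda>A. ((f (insert j A) + f A) / 2)\<^sup>2)
      + cube_avg I (\<lambda>A. ((f (insert j A) - f A) / 2)\<^sup>2)"
proof -
  have "(u\<^sup>2 + v\<^sup>2) / 2 = ((v + u) / 2)\<^sup>2 + ((v - u) / 2)\<^sup>2" for u v :: real
    by (simp add: field_simps power2_eq_square)
  then show ?thesis
    by (simp only: cube_avg_insert[OF I] cube_avg_add)
qed

text \<open>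
  The flips of the old coordinates act on \<open>g\<close> and \<open>h\<close> separately, again without cross terms; the flip
  of \<open>j\<close> maps \<open>g + s h\<close> to \<open>g - s h\<close> and contributes the last term.
\<close>

lemma cube_energy_insert:
  fixes f :: "'a set \<Rightarrow> real"
  assumes I: "finite I" "j \<notin> I"
  defines "g \<equiv> \<lambda>A. (f (insert j A) + f A) / 2"
  defines "h \<equiv> \<lambda>A. (f (insert j A) - f A) / 2"
  shows "cube_energy (insert j I) f = cube_energy I g + cube_energy I h + cube_avg I (\<lambda>A. (h A)\<^sup>2)"
proof -
  have "((\<Sum>i\<in>insert j I. f A * (f A - f (flip i A)) / 2)
      + (\<Sum>i\<in>insert j I. f (insert j A) * (f (insert j A) - f (flip i (insert j A))) / 2)) / 2
    = (\<Sum>i\<in>I. g A * (g A - g (flip i A)) / 2) + (\<Sum>i\<in>I. h A * (h A - h (flip i A)) / 2) + (h A)\<^sup>2"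
    (is "?lhs = ?rhs") if A: "A \<subseteq> I" for A
  proof -
    have jA: "j \<notin> A" using A I by auto
    have fl: "flip i (insert j A) = insert j (flip i A)" if "i \<in> I" for i
      using that I jA by (auto simp: flip_def)
    have "?lhs = (\<Sum>i\<in>I. (f A * (f A - f (flip i A)) / 2
        + f (insert j A) * (f (insert j A) - f (insert j (flip i A))) / 2) / 2)
        + (f A * (f A - f (insert j A)) / 2 + f (insert j A) * (f (insert j A) - f A) / 2) / 2"
      using I jA fl
      by (simp add: sum.distrib sum_divide_distrib add_divide_distrib flip_def[of j])
    also have "\<dots> = (\<Sum>i\<in>I. g A * (g A - g (flip i A)) / 2 + h A * (h A - h (flip i A)) / 2)
        + (h A)\<^sup>2"
      by (intro arg_cong2[where f = "(+)"] sum.cong refl)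
        (simp_all add: g_def h_def field_simps power2_eq_square)
    finally show ?thesis by (simp add: sum.distrib)
  qed
  then show ?thesis
    unfolding cube_energy_def cube_avg_insert[OF I] cube_avg_add[symmetric]
    by (intro cube_avg_cong)
qed

lemma cube_energy_nonneg:
  assumes "finite I"
  shows "cube_energy I f \<ge> 0"
  using assms
proof (induction I arbitrary: f)
  case empty
  then show ?case by (simp add: cube_energy_def)
next
  case (insert j I)
  have "cube_avg I (\<lambda>A. (h A)\<^sup>2) \<ge> 0" for h :: "'a set \<Rightarrow> real"
    by (simp add: cube_avg_def sum_nonneg)
  then show ?case
    using insert by (simp add: cube_energy_insert)
qed

text \<open>
  The spectral gap of \<open>L\<close> is \<open>1\<close>. In the inductive step the new coordinate adds exactly \<open>E h\<^sup>2\<close> to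
  the variance, and at least as much to the energy.
\<close>

lemma cube_poincare:
  assumes "finite I"
  shows "cube_avg I (\<lambda>A. (f A)\<^sup>2) - (cube_avg I f)\<^sup>2 \<le> cube_energy I f"
  using assms
proof (induction I arbitrary: f)
  case empty
  then show ?case by (simp add: cube_energy_def)
next
  case (insert j I)
  define g where "g A = (f (insert j A) + f A) / 2" for A
  define h where "h A = (f (insert j A) - f A) / 2" for A
  have "cube_avg (insert j I) f = cube_avg I g"
    using insert by (simp add: cube_avg_insert g_def[abs_def] add.commute)
  moreover have "cube_avg (insert j I) (\<lambda>A. (f A)\<^sup>2) = cube_avg I (\<lambda>A. (g A)\<^sup>2) + cube_avg I (\<lambda>A. (h A)\<^sup>2)"
    unfolding g_def h_def by (rule cube_avg_square_insert[OF insert(1,2)])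
  moreover have "cube_energy (insert j I) f = cube_energy I g + cube_energy I h + cube_avg I (\<lambda>A. (h A)\<^sup>2)"
    using cube_energy_insert[OF insert(1,2), of f] by (simp add: g_def[abs_def] h_def[abs_def])
  ultimately show ?case
    using insert.IH[of g] cube_energy_nonneg[OF insert(1), of h] by simp
qed

text \<open>
  Among the Walsh coefficients, those of order zero and one are the only ones below the eigenvalue \<open>2\<close>;
  they fall short of it by \<open>2\<close> and by \<open>1\<close>, which gives the two correction terms. In the inductive step
  the coefficient at the new coordinate is the mean of \<open>h\<close>, and the claim for \<open>h\<close> reduces to
  \<open>cube_poincare\<close>.
\<close>

lemma cube_second_order_poincare:
  assumes "finite I"
  shows "2 * cube_avg I (\<lambda>A. (f A)\<^sup>2) - 2 * (cube_avg I f)\<^sup>2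
      - (\<Sum>i\<in>I. (cube_avg I (\<lambda>A. spin A i * f A))\<^sup>2) \<le> cube_energy I f"
  using assms
proof (induction I arbitrary: f)
  case empty
  then show ?case by (simp add: cube_energy_def)
next
  case (insert j I)
  define g where "g A = (f (insert j A) + f A) / 2" for A
  define h where "h A = (f (insert j A) - f A) / 2" for A
  have "cube_avg (insert j I) f = cube_avg I g"
    using insert by (simp add: cube_avg_insert g_def[abs_def] add.commute)
  moreover have "cube_avg (insert j I) (\<lambda>A. (f A)\<^sup>2) = cube_avg I (\<lambda>A. (g A)\<^sup>2) + cube_avg I (\<lambda>A. (h A)\<^sup>2)"
    unfolding g_def h_def by (rule cube_avg_square_insert[OF insert(1,2)])
  moreover have "cube_energy (insert j I) f = cube_energy I g + cube_energy I h + cube_avg I (\<lambda>A. (h A)\<^sup>2)"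
    using cube_energy_insert[OF insert(1,2), of f] by (simp add: g_def[abs_def] h_def[abs_def])
  moreover have "cube_avg (insert j I) (\<lambda>A. spin A j * f A) = cube_avg I h"
    unfolding cube_avg_insert[OF insert(1,2)]
    using insert(2) by (intro cube_avg_cong) (auto simp: spin_def h_def)
  moreover have "cube_avg (insert j I) (\<lambda>A. spin A i * f A) = cube_avg I (\<lambda>A. spin A i * g A)"
    if "i \<in> I" for i
    unfolding cube_avg_insert[OF insert(1,2)]
    using insert(2) that by (intro cube_avg_cong) (auto simp: spin_insert g_def field_simps)
  ultimately show ?case
    using insert.IH[of g] cube_poincare[OF insert(1), of h] insert(1,2) by simp
qed

lemma cube_avg_compl:
  "cube_avg I (\<lambda>A. f (I - A)) = cube_avg I f"
proof -
  have "bij_betw (\<lambda>A. I - A) (Pow I) (Pow I)"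
    by (rule bij_betwI[where g = "\<lambda>A. I - A"]) auto
  then show ?thesis
    by (simp add: cube_avg_def sum.reindex_bij_betw)
qed

text \<open>
  The antipodal map \<open>A \<mapsto> I - A\<close> changes the sign of each \<open>spin A i * f A\<close> when \<open>f\<close> is even, so the
  coefficients of order one vanish.
\<close>

lemma cube_poincare_even:
  assumes "finite I" and even: "\<And>A. A \<subseteq> I \<Longrightarrow> f (I - A) = f A"
  shows "2 * (cube_avg I (\<lambda>A. (f A)\<^sup>2) - (cube_avg I f)\<^sup>2) \<le> cube_energy I f"
proof -
  have "cube_avg I (\<lambda>A. spin A i * f A) = 0" if "i \<in> I" for i
  proof -
    have "cube_avg I (\<lambda>A. spin A i * f A) = cube_avg I (\<lambda>A. spin (I - A) i * f (I - A))"
      by (rule cube_avg_compl[symmetric])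
    also have "\<dots> = cube_avg I (\<lambda>A. - (spin A i * f A))"
      using that by (intro cube_avg_cong) (auto simp: spin_def even)
    finally show ?thesis by (simp add: cube_avg_minus)
  qed
  then show ?thesis using cube_second_order_poincare[OF assms(1), of f] by simp
qed

section \<open>Khinchine's inequality with the optimal constant\<close>

text \<open>Each new coordinate adds \<open>(a j)\<^sup>2\<close>, since the average of \<open>(u - v)\<^sup>2\<close> and \<open>(u + v)\<^sup>2\<close> is \<open>u\<^sup>2 + v\<^sup>2\<close>.\<close>

lemma cube_avg_linear_sq:
  assumes "finite I"
  shows "cube_avg I (\<lambda>A. (\<Sum>i\<in>I. spin A i * a i)\<^sup>2) = (\<Sum>i\<in>I. (a i)\<^sup>2)"
  using assms
proof (induction I)
  case (insert j I)
  have "cube_avg (insert j I) (\<lambda>A. (\<Sum>i\<in>insert j I. spin A i * a i)\<^sup>2)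
      = cube_avg I (\<lambda>A. (\<Sum>i\<in>I. spin A i * a i)\<^sup>2 + (a j)\<^sup>2)"
    unfolding cube_avg_insert[OF insert(1,2)]
  proof (rule cube_avg_cong)
    fix A assume "A \<subseteq> I"
    then have "spin A j = - 1" using insert(2) by (auto simp: spin_def)
    moreover have "(\<Sum>i\<in>I. spin (insert j A) i * a i) = (\<Sum>i\<in>I. spin A i * a i)"
      using insert(2) by (intro sum.cong) (auto simp: spin_insert)
    ultimately show "((\<Sum>i\<in>insert j I. spin A i * a i)\<^sup>2
        + (\<Sum>i\<in>insert j I. spin (insert j A) i * a i)\<^sup>2) / 2
      = (\<Sum>i\<in>I. spin A i * a i)\<^sup>2 + (a j)\<^sup>2"
      using insert(1,2) by (simp add: spin_insert[of j A j] field_simps power2_eq_square)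
  qed
  with insert show ?case by (simp add: cube_avg_add cube_avg_const)
qed simp

text \<open>
  The absolute value \<open>f\<close> of a linear form is even and satisfies \<open>L f \<le> f\<close>: flipping each of the \<open>m\<close>
  coordinates in turn and adding up multiplies the form by \<open>m - 2\<close>, so \<open>\<Sum>\<^sub>i f \<circ> flip\<^sub>i \<ge> (m - 2) f\<close> by
  the triangle inequality. The constant \<open>2\<close> is attained when exactly two
  coefficients are nonzero and these are equal.
\<close>

lemma khinchine_cube:
  fixes a :: "'a \<Rightarrow> real"
  assumes I: "finite I"
  shows "(\<Sum>i\<in>I. (a i)\<^sup>2) \<le> 2 * (cube_avg I (\<lambda>A. \<bar>\<Sum>i\<in>I. spin A i * a i\<bar>))\<^sup>2"
proof -
  define S where "S A = (\<Sum>i\<in>I. spin A i * a i)" for A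
  define f where "f A = \<bar>S A\<bar>" for A
  have S_flip: "S (flip i A) = S A - 2 * (spin A i * a i)" if "i \<in> I" for i A
  proof -
    have "S (flip i A) = (\<Sum>k\<in>I. spin A k * a k - (if k = i then 2 * (spin A i * a i) else 0))"
      unfolding S_def by (rule sum.cong) (simp_all add: spin_flip)
    also have "\<dots> = S A - 2 * (spin A i * a i)"
      unfolding sum_subtractf S_def using I that by simp
    finally show ?thesis .
  qed
  \<comment> \<open>This is \<open>f L f \<le> f\<^sup>2\<close>; it follows from \<open>L f \<le> f\<close> because \<open>f \<ge> 0\<close>.\<close>
  have pt: "(\<Sum>i\<in>I. f A * (f A - f (flip i A)) / 2) \<le> (f A)\<^sup>2" for A
  proof -
    have "(\<Sum>i\<in>I. S (flip i A)) = (\<Sum>i\<in>I. S A - 2 * (spin A i * a i))"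
      by (intro sum.cong refl S_flip)
    also have "\<dots> = real (card I) * S A - 2 * S A"
      unfolding S_def sum_subtractf sum_distrib_left[symmetric] by simp
    finally have "(\<Sum>i\<in>I. S (flip i A)) = (real (card I) - 2) * S A"
      by (simp only: left_diff_distrib)
    then have "\<bar>(real (card I) - 2) * S A\<bar> \<le> (\<Sum>i\<in>I. f (flip i A))"
      unfolding f_def by (metis sum_abs)
    moreover have "(real (card I) - 2) * f A \<le> \<bar>(real (card I) - 2) * S A\<bar>"
      by (simp add: f_def abs_mult mult_right_mono)
    ultimately have "(\<Sum>i\<in>I. f A - f (flip i A)) \<le> 2 * f A"
      by (simp add: sum_subtractf algebra_simps)
    then have "f A / 2 * (\<Sum>i\<in>I. f A - f (flip i A)) \<le> f A / 2 * (2 * f A)"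
      by (intro mult_left_mono) (simp_all add: f_def)
    then show ?thesis
      by (simp add: sum_distrib_left power2_eq_square)
  qed
  have "f (I - A) = f A" if "A \<subseteq> I" for A
  proof -
    have "S (I - A) = (\<Sum>i\<in>I. - (spin A i * a i))"
      unfolding S_def by (intro sum.cong) (auto simp: spin_def)
    then show ?thesis by (simp add: f_def S_def sum_negf)
  qed
  then have "2 * (cube_avg I (\<lambda>A. (f A)\<^sup>2) - (cube_avg I f)\<^sup>2) \<le> cube_energy I f"
    by (rule cube_poincare_even[OF I])
  also have "\<dots> \<le> cube_avg I (\<lambda>A. (f A)\<^sup>2)"
    unfolding cube_energy_def by (intro cube_avg_mono pt)
  finally have "cube_avg I (\<lambda>A. (f A)\<^sup>2) \<le> 2 * (cube_avg I f)\<^sup>2" by simp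
  moreover have "cube_avg I (\<lambda>A. (f A)\<^sup>2) = (\<Sum>i\<in>I. (a i)\<^sup>2)"
    using cube_avg_linear_sq[OF I, of a] by (simp add: f_def S_def)
  ultimately show ?thesis unfolding f_def S_def by (simp only:)
qed

section \<open>From random signs to the cube\<close>

text \<open>
  Independence makes all sign patterns equally likely, and outside a null set the signs are \<open>\<plusminus>1\<close>, so
  that the random norm is a simple function.
\<close>

lemma (in prob_space) expectation_rademacher_sum:
  fixes x :: "'i :: countable \<Rightarrow> 'v :: real_normed_vector"
  assumes I: "finite I"
    and indep: "indep_vars (\<lambda>_. borel) \<epsilon> I"
    and rad: "\<And>i. i \<in> I \<Longrightarrow> rademacher M (\<epsilon> i)"
  shows "expectation (\<lambda>\<omega>. norm (\<Sum>i\<in>I. \<epsilon> i \<omega> *\<^sub>R x i))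
    = cube_avg I (\<lambda>A. norm (\<Sum>i\<in>I. spin A i *\<^sub>R x i))"
proof -
  define v where "v A = norm (\<Sum>i\<in>I. spin A i *\<^sub>R x i)" for A
  define E where "E A = {\<omega> \<in> space M. \<forall>i\<in>I. \<epsilon> i \<omega> = spin A i}" for A
  have meas: "\<epsilon> i \<in> borel_measurable M" if "i \<in> I" for i
    using rad[OF that] by (simp add: rademacher_def)
  have E_sets: "E A \<in> events" for A
  proof -
    have "{\<omega> \<in> space M. \<epsilon> i \<omega> = spin A i} \<in> events" if "i \<in> I" for i
      using meas[OF that] by measurable
    then show ?thesis
      unfolding E_def using I by (intro sets.sets_Collect_finite_All) auto
  qed
  have marginal: "prob (\<epsilon> i -` {spin A i} \<inter> space M) = 1 / 2" if "i \<in> I" for i A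
  proof -
    have "\<epsilon> i -` {spin A i} \<inter> space M = {\<omega> \<in> space M. \<epsilon> i \<omega> = spin A i}"
      by auto
    then show ?thesis
      using rad[OF that] by (simp add: rademacher_def spin_def)
  qed
  have E_prob: "prob (E A) = 1 / 2 ^ card I" for A
  proof (cases "I = {}")
    case True
    then show ?thesis by (simp add: E_def prob_space)
  next
    case False
    have "E A = (\<Inter>i\<in>I. \<epsilon> i -` {spin A i} \<inter> space M)"
      using False by (auto simp: E_def)
    then have "prob (E A) = (\<Prod>i\<in>I. prob (\<epsilon> i -` {spin A i} \<inter> space M))"
      using indep_varsD_finite[OF indep False I, of "\<lambda>i. {spin A i}"] by simp
    then show ?thesis
      by (simp add: marginal power_divide)
  qed
  have "AE \<omega> in M. \<epsilon> i \<omega> = 1 \<or> \<epsilon> i \<omega> = - 1" if "i \<in> I" for i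
  proof -
    note [measurable] = meas[OF that]
    have "prob {\<omega> \<in> space M. \<epsilon> i \<omega> = 1 \<or> \<epsilon> i \<omega> = - 1}
        = prob ({\<omega> \<in> space M. \<epsilon> i \<omega> = 1} \<union> {\<omega> \<in> space M. \<epsilon> i \<omega> = - 1})"
      by (rule arg_cong[where f = prob]) auto
    also have "\<dots> = prob {\<omega> \<in> space M. \<epsilon> i \<omega> = 1} + prob {\<omega> \<in> space M. \<epsilon> i \<omega> = - 1}"
      by (rule finite_measure_Union) auto
    finally have "prob {\<omega> \<in> space M. \<epsilon> i \<omega> = 1 \<or> \<epsilon> i \<omega> = - 1} = 1"
      using rad[OF that] by (simp add: rademacher_def)
    then show ?thesis
      by (subst (asm) prob_Collect_eq_1) auto
  qed
  then have signs: "AE \<omega> in M. \<forall>i\<in>I. \<epsilon> i \<omega> = 1 \<or> \<epsilon> i \<omega> = - 1"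
    by (intro AE_finite_allI[OF I])
  have simple: "norm (\<Sum>i\<in>I. \<epsilon> i \<omega> *\<^sub>R x i) = (\<Sum>A\<in>Pow I. indicator (E A) \<omega> * v A)"
    if \<omega>: "\<omega> \<in> space M" and sg: "\<forall>i\<in>I. \<epsilon> i \<omega> = 1 \<or> \<epsilon> i \<omega> = - 1" for \<omega>
  proof -
    define A0 where "A0 = {i \<in> I. \<epsilon> i \<omega> = 1}"
    have sp: "\<epsilon> i \<omega> = spin A0 i" if "i \<in> I" for i
      using that sg by (auto simp: A0_def spin_def)
    have "\<omega> \<in> E A \<longleftrightarrow> A = A0" if A: "A \<in> Pow I" for A
      using A \<omega> sg by (force simp: E_def A0_def spin_def split: if_splits)
    then have "(\<Sum>A\<in>Pow I. indicator (E A) \<omega> * v A) = (\<Sum>A\<in>Pow I. if A = A0 then v A else 0)"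
      by (intro sum.cong) (auto simp: indicator_def)
    also have "\<dots> = v A0"
      using I by (simp add: A0_def)
    finally show ?thesis by (simp add: v_def sp)
  qed
  have norm_meas: "(\<lambda>\<omega>. norm (\<Sum>i\<in>I. \<epsilon> i \<omega> *\<^sub>R x i)) \<in> borel_measurable M"
  proof -
    \<comment> \<open>The space of the \<open>x i\<close> may fail to be second countable, where sums of measurable maps need not
      be measurable. The norm is therefore taken as a continuous function of the real coefficients.\<close>
    have "(\<lambda>\<omega> i. if i \<in> I then \<epsilon> i \<omega> else 0) \<in> borel_measurable M"
    proof (rule measurable_coordinatewise_then_product)
      show "(\<lambda>\<omega>. if i \<in> I then \<epsilon> i \<omega> else 0) \<in> borel_measurable M" for i
        using meas by (cases "i \<in> I") auto
    qed
    moreover have "continuous_on UNIV (\<lambda>t :: 'i \<Rightarrow> real. norm (\<Sum>i\<in>I. t i *\<^sub>R x i))"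
      by (intro continuous_intros) auto
    then have "(\<lambda>t :: 'i \<Rightarrow> real. norm (\<Sum>i\<in>I. t i *\<^sub>R x i)) \<in> borel_measurable borel"
      by (rule borel_measurable_continuous_onI)
    ultimately have "(\<lambda>\<omega>. norm (\<Sum>i\<in>I. (if i \<in> I then \<epsilon> i \<omega> else 0) *\<^sub>R x i)) \<in> borel_measurable M"
      by (rule measurable_compose)
    then show ?thesis by (simp cong: sum.cong)
  qed
  have "expectation (\<lambda>\<omega>. norm (\<Sum>i\<in>I. \<epsilon> i \<omega> *\<^sub>R x i))
      = expectation (\<lambda>\<omega>. \<Sum>A\<in>Pow I. indicator (E A) \<omega> * v A)"
  proof (rule integral_cong_AE)
    show "(\<lambda>\<omega>. \<Sum>A\<in>Pow I. indicator (E A) \<omega> * v A) \<in> borel_measurable M"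
      using E_sets by measurable
    show "AE \<omega> in M. norm (\<Sum>i\<in>I. \<epsilon> i \<omega> *\<^sub>R x i) = (\<Sum>A\<in>Pow I. indicator (E A) \<omega> * v A)"
      using signs by (rule AE_mp) (auto intro!: AE_I2 simp: simple)
  qed (rule norm_meas)
  also have "\<dots> = (\<Sum>A\<in>Pow I. prob (E A) * v A)"
  proof -
    have "integrable M (indicator (E A) :: _ \<Rightarrow> real)" for A
      using E_sets by (simp add: integrable_real_indicator less_top[symmetric])
    then show ?thesis
      using E_sets by (subst Bochner_Integration.integral_sum) auto
  qed
  finally show ?thesis
    by (simp add: E_prob v_def cube_avg_def sum_divide_distrib)
qed

section \<open>Integration over the functionals\<close>

theorem corollary2p2:
  fixes \<mu> :: "('v :: real_normed_vector \<Rightarrow>\<^sub>L real) measure"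
    and n :: nat
    and x :: "nat \<Rightarrow> 'v"
    and P :: "'w measure"
    and \<epsilon> :: "nat \<Rightarrow> 'w \<Rightarrow> real"
  assumes borel_mu: "sets \<mu> = sets borel"
    and norm_repr: "\<And>v :: 'v. ennreal (norm v) = (\<integral>\<^sup>+ l. ennreal \<bar>blinfun_apply l v\<bar> \<partial>\<mu>)"
    and prob: "prob_space P"
    and indep: "prob_space.indep_vars P (\<lambda>_. borel) \<epsilon> {1..n}"
    and rad: "\<And>i. i \<in> {1..n} \<Longrightarrow> rademacher P (\<epsilon> i)"
  shows "ennreal (2 * (prob_space.expectation P (\<lambda>\<omega>. norm (\<Sum>i=1..n. \<epsilon> i \<omega> *\<^sub>R x i)))\<^sup>2)
     \<ge> (\<integral>\<^sup>+ l. ennreal (sqrt (\<Sum>i=1..n. (blinfun_apply l (x i))\<^sup>2)) \<partial>\<mu>)\<^sup>2"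
proof -
  define I where "I = {1..n}"
  define w where "w A = (\<Sum>i\<in>I. spin A i *\<^sub>R x i)" for A
  define c where "c = sqrt 2 / 2 ^ card I"
  have c0: "c \<ge> 0" by (simp add: c_def)
  have eval_meas: "(\<lambda>l. ennreal \<bar>blinfun_apply l v\<bar>) \<in> borel_measurable \<mu>" for v
  proof -
    have "continuous_on UNIV (\<lambda>l :: 'v \<Rightarrow>\<^sub>L real. blinfun_apply l v)"
      by (intro continuous_intros)
    then have "(\<lambda>l :: 'v \<Rightarrow>\<^sub>L real. blinfun_apply l v) \<in> borel_measurable borel"
      by (rule borel_measurable_continuous_onI)
    then have "(\<lambda>l :: 'v \<Rightarrow>\<^sub>L real. blinfun_apply l v) \<in> borel_measurable \<mu>"
      using measurable_cong_sets[OF borel_mu refl] by blast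
    then show ?thesis by measurable
  qed
  have pointwise: "sqrt (\<Sum>i\<in>I. (blinfun_apply l (x i))\<^sup>2) \<le> c * (\<Sum>A\<in>Pow I. \<bar>blinfun_apply l (w A)\<bar>)" for l
  proof -
    have "sqrt (\<Sum>i\<in>I. (blinfun_apply l (x i))\<^sup>2)
        \<le> sqrt (2 * (cube_avg I (\<lambda>A. \<bar>blinfun_apply l (w A)\<bar>))\<^sup>2)"
      using khinchine_cube[of I "\<lambda>i. blinfun_apply l (x i)"]
      by (simp add: I_def w_def blinfun.sum_right blinfun.scaleR_right)
    also have "\<dots> = c * (\<Sum>A\<in>Pow I. \<bar>blinfun_apply l (w A)\<bar>)"
      by (simp add: real_sqrt_mult cube_avg_def c_def sum_nonneg)
    finally show ?thesis .
  qed
  have "(\<integral>\<^sup>+ l. ennreal (sqrt (\<Sum>i\<in>I. (blinfun_apply l (x i))\<^sup>2)) \<partial>\<mu>)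
      \<le> (\<integral>\<^sup>+ l. ennreal c * (\<Sum>A\<in>Pow I. ennreal \<bar>blinfun_apply l (w A)\<bar>) \<partial>\<mu>)"
    using pointwise
    by (intro nn_integral_mono) (simp add: c0 sum_nonneg ennreal_mult[symmetric] ennreal_leI)
  also have "\<dots> = ennreal c * (\<Sum>A\<in>Pow I. ennreal (norm (w A)))"
    using eval_meas
    by (simp add: nn_integral_cmult nn_integral_sum norm_repr del: sum_ennreal)
  also have "\<dots> = ennreal (sqrt 2 * cube_avg I (\<lambda>A. norm (w A)))"
    by (simp add: c0 sum_nonneg ennreal_mult[symmetric] c_def cube_avg_def)
  also have "cube_avg I (\<lambda>A. norm (w A)) = prob_space.expectation P (\<lambda>\<omega>. norm (\<Sum>i=1..n. \<epsilon> i \<omega> *\<^sub>R x i))"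
    using prob_space.expectation_rademacher_sum[OF prob finite_atLeastAtMost indep rad, of x]
    by (simp add: I_def w_def)
  finally have "(\<integral>\<^sup>+ l. ennreal (sqrt (\<Sum>i\<in>I. (blinfun_apply l (x i))\<^sup>2)) \<partial>\<mu>)\<^sup>2
      \<le> (ennreal (sqrt 2 * prob_space.expectation P (\<lambda>\<omega>. norm (\<Sum>i=1..n. \<epsilon> i \<omega> *\<^sub>R x i))))\<^sup>2"
    by (rule power_mono) simp
  then show ?thesis
    by (simp add: I_def ennreal_power power_mult_distrib)
qed

end
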